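(* Let $q\in\mathbb{C}$ with $0<|q|<1$ and $x,y\in\mathbb{C}$. Then for every $n\in\mathbb{N}_0$, \[ \mathfrak{B}_{n,q}(x,y)=\sum_{k=0}^{n}\begin{bmatrix}n\\k\end{bmatrix}_q\left(\mathfrak{B}_{k,q}(0,y)+q^{\frac12(k-1)(k-2)}\frac{[k]_q}{2}\,y^{k-1}\right)\mathfrak{E}_{n-k,q}(x,0), \] where for $k=0$ the term containing the factor $[k]_q=0$ is read as $0$.
   Context: $\mathbb{N}_0=\{0,1,2,\dots\}$. For $q\in\mathbb{C}$, $0<|q|<1$: $[n]_q=\frac{1-q^n}{1-q}$, $[0]_q!=1$, $[n]_q!=[1]_q[2]_q\cdots[n]_q$, and $\begin{bmatrix}n\\k\end{bmatrix}_q=\frac{[n]_q!}{[k]_q![n-k]_q!}$ for $0\le k\le n$. Set $e_q(z)=\sum_{n\ge0}\frac{z^n}{[n]_q!}$ and $E_q(z)=\sum_{n\ge0}\frac{q^{n(n-1)/2}z^n}{[n]_q!}$. The $q$-Bernoulli and $q$-Euler polynomials are defined by the power series expansions in $t$ around $0$ \[ \frac{t}{e_q(t)-1}e_q(tx)E_q(ty)=\sum_{n=0}^\infty\mathfrak{B}_{n,q}(x,y)\frac{t^n}{[n]_q!},\qquad \frac{2}{e_q(t)+1}e_q(tx)E_q(ty)=\sum_{n=0}^\infty\mathfrak{E}_{n,q}(x,y)\frac{t^n}{[n]_q!}. \] *)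

theory Defs
  imports "HOL-Complex_Analysis.Complex_Analysis"
begin

definition q_nat :: "complex \<Rightarrow> nat \<Rightarrow> complex" where
  "q_nat q n = (1 - q ^ n) / (1 - q)"

definition q_fact :: "complex \<Rightarrow> nat \<Rightarrow> complex" where
  "q_fact q n = (\<Prod>i=1..n. q_nat q i)"

text \<open>Only meaningful for \<open>k \<le> n\<close>.\<close>
definition q_binomial :: "complex \<Rightarrow> nat \<Rightarrow> nat \<Rightarrow> complex" where
  "q_binomial q n k = q_fact q n / (q_fact q k * q_fact q (n - k))"

text \<open>The first series converges only for \<open>norm z < 1 / norm (1 - q)\<close>; only its values
  near \<open>0\<close> are used below.\<close>
definition q_exp :: "complex \<Rightarrow> complex \<Rightarrow> complex" where
  "q_exp q z = (\<Sum>n. z ^ n / q_fact q n)"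

definition q_Exp :: "complex \<Rightarrow> complex \<Rightarrow> complex" where
  "q_Exp q z = (\<Sum>n. q ^ (n * (n - 1) div 2) * z ^ n / q_fact q n)"

text \<open>The singularity of \<open>t / (q_exp q t - 1)\<close> at \<open>0\<close> is removable; the value there is
  fixed to be the limit, as \<open>0 / 0 = 0\<close> would make the function discontinuous.\<close>
definition q_bernoulli_gf :: "complex \<Rightarrow> complex \<Rightarrow> complex \<Rightarrow> complex \<Rightarrow> complex" where
  "q_bernoulli_gf q x y t =
     (if t = 0 then 1 else t / (q_exp q t - 1)) * q_exp q (t * x) * q_Exp q (t * y)"

definition q_euler_gf :: "complex \<Rightarrow> complex \<Rightarrow> complex \<Rightarrow> complex \<Rightarrow> complex" where
  "q_euler_gf q x y t = 2 / (q_exp q t + 1) * q_exp q (t * x) * q_Exp q (t * y)"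

definition q_bernoulli :: "complex \<Rightarrow> nat \<Rightarrow> complex \<Rightarrow> complex \<Rightarrow> complex" where
  "q_bernoulli q n x y = fps_nth (fps_expansion (q_bernoulli_gf q x y) 0) n * q_fact q n"

definition q_euler :: "complex \<Rightarrow> nat \<Rightarrow> complex \<Rightarrow> complex \<Rightarrow> complex" where
  "q_euler q n x y = fps_nth (fps_expansion (q_euler_gf q x y) 0) n * q_fact q n"

end

theory Submission
  imports Defs
begin

text \<open>
  Write \<open>e(t)\<close> for \<^term>\<open>q_exp q t\<close> and \<open>E(t)\<close> for \<^term>\<open>q_Exp q t\<close>. The identity is the
  coefficientwise form of the factorisation

    \<open>t / (e(t) - 1) = (t / (e(t) - 1) + t / 2) \<cdot> (2 / (e(t) + 1))\<close>

  multiplied by \<open>e(t x) E(t y)\<close>. On the right, \<open>E(t y)\<close> goes with the first factor and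
  \<open>e(t x)\<close> with the second: the first becomes the generating function of the
  \<^term>\<open>q_bernoulli q k 0 y\<close> plus \<open>t E(t y) / 2\<close>, the second that of the
  \<^term>\<open>q_euler q k x 0\<close>, and the \<open>q\<close>-binomial coefficients are what the Cauchy product of two
  series in \<open>t\<^sup>n / [n]!\<close> produces. In \<open>t E(t y) / 2\<close> the coefficient of index \<open>k - 1\<close> of
  \<open>E(t y)\<close> moves to index \<open>k\<close>, and the factor \<open>[k]\<close> compensates \<open>[k]! = [k - 1]! [k]\<close>.

  The polynomials are Taylor coefficients of analytic functions, so this argument takes place
  among formal power series once the generating functions are known to be represented by
  the expected series (\<open>q_bernoulli_gf_expansion\<close>, \<open>q_euler_gf_expansion\<close>). For this, the
  two \<open>q\<close>-exponentials need a positive radius of convergence, which follows from a lower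
  bound on \<open>[n]\<close>, and the removable singularity of \<open>t / (e(t) - 1)\<close> is resolved by
  cancelling \<open>t\<close>.
\<close>

section \<open>Convergence of the q-exponential series\<close>

lemma q_nat_norm_ge:
  assumes "norm q < 1" "n \<ge> 1"
  shows "norm (q_nat q n) \<ge> (1 - norm q) / norm (1 - q)"
proof -
  have "norm (q ^ n) \<le> norm q"
    using assms power_decreasing[of 1 n "norm q"] by (simp add: norm_power)
  moreover have "1 - norm (q ^ n) \<le> norm (1 - q ^ n)"
    using norm_triangle_ineq2[of 1 "q ^ n"] by simp
  ultimately show ?thesis
    by (simp add: q_nat_def norm_divide divide_right_mono)
qed

lemma q_nat_nonzero:
  assumes "norm q < 1" "n \<ge> 1"
  shows "q_nat q n \<noteq> 0"
proof -
  have "q \<noteq> 1" using assms by auto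
  hence "(1 - norm q) / norm (1 - q) > 0" using assms by simp
  with q_nat_norm_ge[OF assms] show ?thesis by auto
qed

lemma q_fact_0 [simp]: "q_fact q 0 = 1"
  by (simp add: q_fact_def)

lemma q_fact_Suc: "q_fact q (Suc n) = q_fact q n * q_nat q (Suc n)"
  by (simp add: q_fact_def)

lemma q_fact_nonzero: "norm q < 1 \<Longrightarrow> q_fact q n \<noteq> 0"
  by (simp add: q_fact_def q_nat_nonzero)

lemma q_fact_norm_ge:
  assumes "norm q < 1"
  shows "norm (q_fact q n) \<ge> ((1 - norm q) / norm (1 - q)) ^ n"
proof (induction n)
  case (Suc n)
  have "((1 - norm q) / norm (1 - q)) ^ n * ((1 - norm q) / norm (1 - q))
          \<le> norm (q_fact q n) * norm (q_nat q (Suc n))"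
    using assms by (intro mult_mono Suc.IH q_nat_norm_ge) auto
  thus ?case by (simp add: q_fact_Suc norm_mult mult.commute)
qed simp

text \<open>Since \<open>[n]!\<close> is bounded below by a geometric sequence, numerators of at most geometric growth
  give a series with positive radius of convergence. This covers \<open>e(t x)\<close> and \<open>E(t y)\<close>
  at once, with \<open>x\<close> and \<open>y\<close> absorbed in the coefficients.\<close>

lemma q_factorial_series_expansion:
  assumes q: "norm q < 1" and C: "C > 0" and a: "\<And>n. norm (a n) \<le> C ^ n"
  shows "(\<lambda>t. \<Sum>n. a n * t ^ n / q_fact q n) has_fps_expansion Abs_fps (\<lambda>n. a n / q_fact q n)"
proof -
  define d where "d = (1 - norm q) / norm (1 - q)"
  have "q \<noteq> 1" using q by auto
  hence d: "d > 0" using q by (simp add: d_def)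
  \<comment> \<open>At this radius the terms are at most \<open>(1/2)\<^sup>n\<close>.\<close>
  define z where "z = complex_of_real (d / (2 * C))"
  have "norm (a n / q_fact q n * z ^ n) \<le> (1 / 2) ^ n" for n
  proof -
    have "norm (a n / q_fact q n * z ^ n) = norm (a n) / norm (q_fact q n) * (d / (2 * C)) ^ n"
      using C d by (simp add: z_def norm_mult norm_divide norm_power)
    also have "\<dots> \<le> C ^ n / d ^ n * (d / (2 * C)) ^ n"
      using C d a[of n] q_fact_norm_ge[OF q, of n, folded d_def]
      by (intro mult_right_mono frac_le zero_le_power) auto
    also have "\<dots> = (1 / 2) ^ n"
      using C d by (simp add: power_divide power_mult_distrib)
    finally show ?thesis .
  qed
  hence "summable (\<lambda>n. a n / q_fact q n * z ^ n)"
    by (intro summable_comparison_test'[OF summable_geometric, of "1/2"]) auto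
  hence "conv_radius (\<lambda>n. a n / q_fact q n) \<ge> norm z"
    by (rule conv_radius_geI)
  moreover have "norm z > 0" using C d by (simp add: z_def)
  ultimately have "conv_radius (\<lambda>n. a n / q_fact q n) > 0"
    by (metis ereal_less(2) order_less_le_trans)
  hence "fps_conv_radius (Abs_fps (\<lambda>n. a n / q_fact q n)) > 0"
    by (simp add: fps_conv_radius_def)
  hence "eval_fps (Abs_fps (\<lambda>n. a n / q_fact q n)) has_fps_expansion
           Abs_fps (\<lambda>n. a n / q_fact q n)"
    by (rule eval_fps_has_fps_expansion)
  moreover have "eval_fps (Abs_fps (\<lambda>n. a n / q_fact q n)) =
                   (\<lambda>t. \<Sum>n. a n * t ^ n / q_fact q n)"
    by (simp add: eval_fps_def fun_eq_iff)
  ultimately show ?thesis by simp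
qed

definition q_exp_fps :: "complex \<Rightarrow> complex \<Rightarrow> complex fps" where
  "q_exp_fps q x = Abs_fps (\<lambda>n. x ^ n / q_fact q n)"

definition q_Exp_fps :: "complex \<Rightarrow> complex \<Rightarrow> complex fps" where
  "q_Exp_fps q y = Abs_fps (\<lambda>n. q ^ (n * (n - 1) div 2) * y ^ n / q_fact q n)"

lemma q_exp_expansion:
  assumes "norm q < 1"
  shows "(\<lambda>t. q_exp q (t * x)) has_fps_expansion q_exp_fps q x"
proof -
  have "norm (x ^ n) \<le> (1 + norm x) ^ n" for n
    by (simp add: norm_power power_mono)
  from q_factorial_series_expansion[OF assms _ this] show ?thesis
    by (simp add: q_exp_def q_exp_fps_def power_mult_distrib mult_ac add_pos_nonneg)
qed

lemma q_Exp_expansion: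
  assumes "norm q < 1"
  shows "(\<lambda>t. q_Exp q (t * y)) has_fps_expansion q_Exp_fps q y"
proof -
  have "norm (q ^ (n * (n - 1) div 2) * y ^ n) \<le> (1 + norm y) ^ n" for n
  proof -
    have "norm (q ^ (n * (n - 1) div 2) * y ^ n) \<le> 1 * (1 + norm y) ^ n"
      unfolding norm_mult norm_power using assms
      by (intro mult_mono power_mono power_le_one) auto
    thus ?thesis by simp
  qed
  from q_factorial_series_expansion[OF assms _ this] show ?thesis
    by (simp add: q_Exp_def q_Exp_fps_def power_mult_distrib mult_ac add_pos_nonneg)
qed

lemma q_exp_fps_0 [simp]: "q_exp_fps q 0 = 1"
  by (rule fps_ext) (simp add: q_exp_fps_def power_0_left)

lemma q_Exp_fps_0 [simp]: "q_Exp_fps q 0 = 1"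
  by (rule fps_ext) (simp add: q_Exp_fps_def power_0_left)

section \<open>Power series of the generating functions\<close>

text \<open>The series of \<open>(e(t) - 1) / t\<close>. Its constant term is \<open>1\<close>, so it is invertible.\<close>

definition q_exp_quot_fps :: "complex \<Rightarrow> complex fps" where
  "q_exp_quot_fps q = fps_shift 1 (q_exp_fps q 1)"

lemma q_exp_fps_eq: "q_exp_fps q 1 = 1 + fps_X * q_exp_quot_fps q"
  by (rule fps_ext) (simp add: q_exp_quot_fps_def q_exp_fps_def)

lemma q_exp_quot_fps_nth_0:
  assumes "norm q < 1"
  shows "fps_nth (q_exp_quot_fps q) 0 = 1"
proof -
  have "q \<noteq> 1" using assms by auto
  thus ?thesis
    by (simp add: q_exp_quot_fps_def q_exp_fps_def q_fact_Suc q_nat_def)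
qed

text \<open>Away from \<open>0\<close> the factor \<open>t\<close> cancels, and at \<open>0\<close> the prescribed value \<open>1\<close> is the
  inverse of the constant term of \<^term>\<open>q_exp_quot_fps q\<close>.\<close>

lemma bernoulli_factor_expansion:
  assumes "norm q < 1"
  shows "(\<lambda>t. if t = 0 then 1 else t / (q_exp q t - 1)) has_fps_expansion
           inverse (q_exp_quot_fps q)"
proof -
  define G where "G = q_exp_quot_fps q"
  have G0: "fps_nth G 0 = 1"
    using q_exp_quot_fps_nth_0[OF assms] by (simp add: G_def)
  have e: "q_exp q has_fps_expansion (1 + fps_X * G)"
    using q_exp_expansion[OF assms, of 1] by (simp add: q_exp_fps_eq G_def)
  have "fps_conv_radius (q_exp_fps q 1) > 0"
    using q_exp_expansion[OF assms, of 1] by (simp add: has_fps_expansion_def)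
  hence "fps_conv_radius G > 0"
    by (simp add: G_def q_exp_quot_fps_def)
  hence G: "eval_fps G has_fps_expansion G"
    by (rule eval_fps_has_fps_expansion)
  hence "(\<lambda>t. 1 + t * eval_fps G t) has_fps_expansion (1 + fps_X * G)"
    by (intro fps_expansion_intros)
  with e have "eventually (\<lambda>t. q_exp q t = 1 + t * eval_fps G t) (nhds 0)"
    unfolding has_fps_expansion_def by (auto elim: eventually_elim2)
  hence "eventually (\<lambda>t. (if t = 0 then 1 else t / (q_exp q t - 1)) =
           inverse (eval_fps G t)) (nhds 0)"
    by eventually_elim (auto simp: eval_fps_at_0 G0 field_simps)
  hence "(\<lambda>t. if t = 0 then 1 else t / (q_exp q t - 1)) has_fps_expansion inverse G \<longleftrightarrow>
           (\<lambda>t. inverse (eval_fps G t)) has_fps_expansion inverse G"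
    by (intro has_fps_expansion_cong refl)
  moreover have "(\<lambda>t. inverse (eval_fps G t)) has_fps_expansion inverse G"
    using G G0 by (intro has_fps_expansion_inverse) auto
  ultimately show ?thesis
    by (simp add: G_def)
qed

lemma q_bernoulli_gf_expansion:
  assumes "norm q < 1"
  shows "q_bernoulli_gf q x y has_fps_expansion
           inverse (q_exp_quot_fps q) * q_exp_fps q x * q_Exp_fps q y"
  unfolding q_bernoulli_gf_def [abs_def]
  by (intro has_fps_expansion_mult bernoulli_factor_expansion q_exp_expansion
        q_Exp_expansion assms)

lemma q_euler_gf_expansion:
  assumes "norm q < 1"
  shows "q_euler_gf q x y has_fps_expansion
           2 * inverse (q_exp_fps q 1 + 1) * q_exp_fps q x * q_Exp_fps q y"
proof -
  have "fps_nth (q_exp_fps q 1 + 1) 0 \<noteq> 0"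
    by (simp add: q_exp_fps_def)
  moreover have "(\<lambda>t. q_exp q t + 1) has_fps_expansion (q_exp_fps q 1 + 1)"
    using q_exp_expansion[OF assms, of 1] by (intro fps_expansion_intros) simp
  ultimately show ?thesis
    unfolding q_euler_gf_def [abs_def] divide_inverse
    by (intro has_fps_expansion_mult has_fps_expansion_inverse has_fps_expansion_numeral
          q_exp_expansion q_Exp_expansion assms)
qed

lemma q_bernoulli_eq:
  assumes "norm q < 1"
  shows "q_bernoulli q n x y =
           fps_nth (inverse (q_exp_quot_fps q) * q_exp_fps q x * q_Exp_fps q y) n * q_fact q n"
  by (simp add: q_bernoulli_def fps_expansion_eqI[OF q_bernoulli_gf_expansion[OF assms]])

lemma q_euler_eq:
  assumes "norm q < 1"
  shows "q_euler q n x y =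
           fps_nth (2 * inverse (q_exp_fps q 1 + 1) * q_exp_fps q x * q_Exp_fps q y) n * q_fact q n"
  by (simp add: q_euler_def fps_expansion_eqI[OF q_euler_gf_expansion[OF assms]])

section \<open>Comparison of coefficients\<close>

text \<open>With \<open>G\<close> the series of \<open>(e(t) - 1) / t\<close>, multiplying by \<open>G (e(t) + 1)\<close> reduces the
  claim to \<open>2 + t G = e(t) + 1\<close>.\<close>

lemma bernoulli_factor_eq_euler_factor:
  assumes "norm q < 1"
  shows "inverse (q_exp_quot_fps q) =
           (inverse (q_exp_quot_fps q) + fps_const (1/2) * fps_X) *
             (2 * inverse (q_exp_fps q 1 + 1))"
proof -
  define G E where "G = q_exp_quot_fps q" and "E = q_exp_fps q 1 + 1"
  have G: "inverse G * G = 1"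
    using q_exp_quot_fps_nth_0[OF assms] by (intro inverse_mult_eq_1) (simp add: G_def)
  have E: "inverse E * E = 1"
    by (intro inverse_mult_eq_1) (simp add: E_def q_exp_fps_def)
  have half: "2 * fps_const (1/2 :: complex) = 1"
    by (simp add: fps_eq_iff numeral_fps_const)
  have "E = 2 + fps_X * G"
    by (simp add: E_def G_def q_exp_fps_eq)
  hence "inverse G * E = 2 * inverse G + fps_X * (inverse G * G)"
    by (simp add: algebra_simps)
  also have "\<dots> = 2 * inverse G + 2 * fps_const (1/2) * fps_X"
    by (simp add: G half)
  also have "\<dots> = 2 * (inverse G + fps_const (1/2) * fps_X)"
    by (simp add: algebra_simps)
  finally have "inverse G * (inverse E * E) =
                  (inverse G + fps_const (1/2) * fps_X) * (2 * inverse E)"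
    by (simp add: mult_ac)
  thus ?thesis unfolding E mult_1_right by (simp only: G_def E_def)
qed

lemma half_X_q_Exp_fps_nth:
  assumes "norm q < 1"
  shows "fps_nth (fps_const (1/2) * fps_X * q_Exp_fps q y) k * q_fact q k =
           q ^ ((k - 1) * (k - 2) div 2) * (q_nat q k / 2) * y ^ (k - 1)"
proof (cases k)
  case 0
  thus ?thesis by (simp add: q_nat_def mult.assoc)
next
  case (Suc m)
  thus ?thesis
    using q_fact_nonzero[OF assms, of m]
    by (simp add: q_Exp_fps_def q_fact_Suc mult.assoc)
qed

theorem corollary11:
  fixes q x y :: complex and n :: nat
  assumes "0 < norm q" and "norm q < 1"
  shows "q_bernoulli q n x y =
    (\<Sum>k=0..n. q_binomial q n k *
       (q_bernoulli q k 0 y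
          + q ^ ((k - 1) * (k - 2) div 2) * (q_nat q k / 2) * y ^ (k - 1)) *
       q_euler q (n - k) x 0)"
proof -
  note q = \<open>norm q < 1\<close>
  define A where "A = (inverse (q_exp_quot_fps q) + fps_const (1/2) * fps_X) * q_Exp_fps q y"
  define B where "B = 2 * inverse (q_exp_fps q 1 + 1) * q_exp_fps q x"
  have A: "fps_nth A k * q_fact q k = q_bernoulli q k 0 y
             + q ^ ((k - 1) * (k - 2) div 2) * (q_nat q k / 2) * y ^ (k - 1)" for k
    unfolding half_X_q_Exp_fps_nth[OF q, symmetric] q_bernoulli_eq[OF q]
    by (simp add: A_def distrib_right)
  have B: "fps_nth B k * q_fact q k = q_euler q k x 0" for k
    by (simp add: B_def q_euler_eq[OF q])
  have "inverse (q_exp_quot_fps q) * q_exp_fps q x * q_Exp_fps q y = A * B"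
    by (subst bernoulli_factor_eq_euler_factor[OF q]) (simp only: A_def B_def mult_ac)
  hence "q_bernoulli q n x y = (\<Sum>k=0..n. fps_nth A k * fps_nth B (n - k)) * q_fact q n"
    by (simp add: q_bernoulli_eq[OF q] fps_mult_nth)
  also have "\<dots> = (\<Sum>k=0..n. q_binomial q n k * (fps_nth A k * q_fact q k) *
                     (fps_nth B (n - k) * q_fact q (n - k)))"
    unfolding sum_distrib_right
    by (intro sum.cong refl) (simp add: q_binomial_def q_fact_nonzero[OF q] field_simps)
  finally show ?thesis by (simp only: A B)
qed

end
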